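(* Let $\rho,l,k_0,c_0>0$, $T_0>0$, $T_f<T_0$, $\delta\ge 0$, $p\ge 0$ be fixed and put $a=\sqrt{k_0/(\rho c_0)}$. For $\gamma>0$ let $h=\gamma k_0/(2a)$ and let $(T_\gamma,s_\gamma)$ be the unique similarity type solution to the Stefan problem with Robin condition $$\rho\, c(T)\frac{\partial T}{\partial t}=\frac{\partial}{\partial x}\Big(k(T)\frac{\partial T}{\partial x}\Big),\quad 0<x<s(t),\ t>0,$$ $$k(T(0,t))\frac{\partial T}{\partial x}(0,t)=\frac{h}{\sqrt t}\big(T(0,t)-T_0\big),\quad t>0,$$ $$T(s(t),t)=T_f,\qquad k_0\frac{\partial T}{\partial x}(s(t),t)=-\rho\, l\,\dot s(t),\quad t>0,\qquad s(0)=0.$$ Let $(T,s)$ be the unique similarity type solution to the Stefan problem obtained from it by replacing the Robin condition at $x=0$ by the Dirichlet condition $T(0,t)=T_0$, $t>0$. Then $(T_\gamma,s_\gamma)$ converges pointwise to $(T,s)$ when $\gamma\to\infty$; that is, $s_\gamma(t)\to s(t)$ for every $t>0$, and $T_\gamma(x,t)\to T(x,t)$ for every $t>0$ and $0<x<s(t)$.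
   Context: The thermal conductivity and specific heat are $$k(T)=k_0\Big(1+\delta\Big(\frac{T-T_f}{T_0-T_f}\Big)^p\Big),\qquad c(T)=c_0\Big(1+\delta\Big(\frac{T-T_f}{T_0-T_f}\Big)^p\Big),$$ where $k_0=k(T_f)$ and $c_0=c(T_f)$ are the reference thermal conductivity and specific heat. $\rho$ is the density, $l$ the latent heat per unit mass, $h$ the thermal transfer coefficient, $T_f$ the phase change temperature. A similarity type solution is a solution $(T,s)$ (equations understood in the classical sense) of the form $T(x,t)=(T_0-T_f)\,y(\eta)+T_f$ with $\eta=x/(2a\sqrt t)$ and $s(t)=2a\lambda\sqrt t$, for some parameter $\lambda>0$ and some function $y\ge 0$ of the single variable $\eta\in[0,\lambda]$. The value $T_\gamma(x,t)$ is defined for $0<x<s_\gamma(t)$; the limit at a point $(x,t)$ is taken over those (sufficiently large) $\gamma$ for which $x<s_\gamma(t)$. *)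

theory Defs
  imports "HOL-Analysis.Analysis"
begin

text \<open>Real powers of a base \<open>u \<ge> 0\<close> with \<open>u\<^sup>0 = 1\<close> also at \<open>u = 0\<close>
  (note that \<open>0 powr 0 = 0\<close>), so that \<open>p = 0\<close> gives constant coefficients.\<close>

definition rpow :: "real \<Rightarrow> real \<Rightarrow> real" where
  "rpow u p = (if p = 0 then 1 else u powr p)"

text \<open>With \<open>\<kappa> = k\<^sub>0\<close> this is the conductivity \<open>k(T)\<close>, with \<open>\<kappa> = c\<^sub>0\<close> the specific heat \<open>c(T)\<close>.\<close>

definition thermal_coeff :: "real \<Rightarrow> real \<Rightarrow> real \<Rightarrow> real \<Rightarrow> real \<Rightarrow> real \<Rightarrow> real" where
  "thermal_coeff \<kappa> T0 Tf \<delta> p \<theta> = \<kappa> * (1 + \<delta> * rpow ((\<theta> - Tf) / (T0 - Tf)) p)"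

text \<open>The values \<open>T x t\<close> are only meaningful for \<open>t > 0\<close> and \<open>0 \<le> x \<le> s t\<close>, and those of
  \<open>s\<close> for \<open>t \<ge> 0\<close>; no predicate below constrains \<open>T\<close> or \<open>s\<close> elsewhere.
  Continuity up to the boundary ties the boundary values of \<open>T\<close> to its interior values;
  spatial derivatives at a boundary point are one-sided.\<close>

definition heat_equation ::
    "real \<Rightarrow> (real \<Rightarrow> real) \<Rightarrow> (real \<Rightarrow> real) \<Rightarrow> (real \<Rightarrow> real \<Rightarrow> real) \<Rightarrow> (real \<Rightarrow> real) \<Rightarrow> bool" where
  "heat_equation \<rho> k c T s \<longleftrightarrow>
     (\<forall>t>0. \<forall>x. 0 < x \<and> x < s t \<longrightarrow>
        (\<lambda>\<tau>. T x \<tau>) field_differentiable (at t) \<and>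
        (\<lambda>\<xi>. T \<xi> t) field_differentiable (at x) \<and>
        (\<lambda>\<xi>. k (T \<xi> t) * deriv (\<lambda>z. T z t) \<xi>) field_differentiable (at x) \<and>
        \<rho> * c (T x t) * deriv (\<lambda>\<tau>. T x \<tau>) t =
          deriv (\<lambda>\<xi>. k (T \<xi> t) * deriv (\<lambda>z. T z t) \<xi>) x)"

definition free_boundary_conditions ::
    "real \<Rightarrow> real \<Rightarrow> real \<Rightarrow> real \<Rightarrow> (real \<Rightarrow> real \<Rightarrow> real) \<Rightarrow> (real \<Rightarrow> real) \<Rightarrow> bool" where
  "free_boundary_conditions \<rho> l k0 Tf T s \<longleftrightarrow>
     s 0 = 0 \<and>
     (\<forall>t>0. T (s t) t = Tf \<and>
        (\<exists>q v. ((\<lambda>x. T x t) has_real_derivative q) (at (s t) within {0..s t}) \<and>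
               (s has_real_derivative v) (at t) \<and>
               k0 * q = - (\<rho> * l * v)))"

definition robin_condition ::
    "(real \<Rightarrow> real) \<Rightarrow> real \<Rightarrow> real \<Rightarrow> (real \<Rightarrow> real \<Rightarrow> real) \<Rightarrow> (real \<Rightarrow> real) \<Rightarrow> bool" where
  "robin_condition k h T0 T s \<longleftrightarrow>
     (\<forall>t>0. \<exists>q. ((\<lambda>x. T x t) has_real_derivative q) (at 0 within {0..s t}) \<and>
        k (T 0 t) * q = h / sqrt t * (T 0 t - T0))"

definition dirichlet_condition :: "real \<Rightarrow> (real \<Rightarrow> real \<Rightarrow> real) \<Rightarrow> bool" where
  "dirichlet_condition T0 T \<longleftrightarrow> (\<forall>t>0. T 0 t = T0)"

definition stefan_common ::
    "real \<Rightarrow> real \<Rightarrow> real \<Rightarrow> real \<Rightarrow> real \<Rightarrow> real \<Rightarrow> real \<Rightarrow> real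
     \<Rightarrow> (real \<Rightarrow> real \<Rightarrow> real) \<Rightarrow> (real \<Rightarrow> real) \<Rightarrow> bool" where
  "stefan_common \<rho> l k0 c0 T0 Tf \<delta> p T s \<longleftrightarrow>
     continuous_on {(x, t). 0 < t \<and> 0 \<le> x \<and> x \<le> s t} (\<lambda>(x, t). T x t) \<and>
     heat_equation \<rho> (thermal_coeff k0 T0 Tf \<delta> p) (thermal_coeff c0 T0 Tf \<delta> p) T s \<and>
     free_boundary_conditions \<rho> l k0 Tf T s"

definition similarity_type ::
    "real \<Rightarrow> real \<Rightarrow> real \<Rightarrow> (real \<Rightarrow> real \<Rightarrow> real) \<Rightarrow> (real \<Rightarrow> real) \<Rightarrow> bool" where
  "similarity_type a T0 Tf T s \<longleftrightarrow>
     (\<exists>lam>0. \<exists>y. (\<forall>\<eta>\<in>{0..lam}. 0 \<le> y \<eta>) \<and>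
        (\<forall>t\<ge>0. s t = 2 * a * lam * sqrt t) \<and>
        (\<forall>t>0. \<forall>x\<in>{0..s t}. T x t = (T0 - Tf) * y (x / (2 * a * sqrt t)) + Tf))"

definition robin_similarity_solution ::
    "real \<Rightarrow> real \<Rightarrow> real \<Rightarrow> real \<Rightarrow> real \<Rightarrow> real \<Rightarrow> real \<Rightarrow> real \<Rightarrow> real \<Rightarrow> real
     \<Rightarrow> (real \<Rightarrow> real \<Rightarrow> real) \<Rightarrow> (real \<Rightarrow> real) \<Rightarrow> bool" where
  "robin_similarity_solution \<rho> l k0 c0 T0 Tf \<delta> p a h T s \<longleftrightarrow>
     stefan_common \<rho> l k0 c0 T0 Tf \<delta> p T s \<and>
     robin_condition (thermal_coeff k0 T0 Tf \<delta> p) h T0 T s \<and>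
     similarity_type a T0 Tf T s"

definition dirichlet_similarity_solution ::
    "real \<Rightarrow> real \<Rightarrow> real \<Rightarrow> real \<Rightarrow> real \<Rightarrow> real \<Rightarrow> real \<Rightarrow> real \<Rightarrow> real
     \<Rightarrow> (real \<Rightarrow> real \<Rightarrow> real) \<Rightarrow> (real \<Rightarrow> real) \<Rightarrow> bool" where
  "dirichlet_similarity_solution \<rho> l k0 c0 T0 Tf \<delta> p a T s \<longleftrightarrow>
     stefan_common \<rho> l k0 c0 T0 Tf \<delta> p T s \<and>
     dirichlet_condition T0 T \<and>
     similarity_type a T0 Tf T s"

text \<open>Existence and uniqueness; two pairs are identified when they agree on the domain
  \<open>t > 0\<close>, \<open>0 \<le> x \<le> s t\<close> (for \<open>s\<close>: \<open>t \<ge> 0\<close>) where they are meaningful.\<close>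

definition uniquely_solvable ::
    "((real \<Rightarrow> real \<Rightarrow> real) \<Rightarrow> (real \<Rightarrow> real) \<Rightarrow> bool) \<Rightarrow> bool" where
  "uniquely_solvable P \<longleftrightarrow>
     (\<exists>T s. P T s) \<and>
     (\<forall>T s T' s'. P T s \<and> P T' s' \<longrightarrow>
        (\<forall>t\<ge>0. s t = s' t) \<and> (\<forall>t>0. \<forall>x\<in>{0..s t}. T x t = T' x t))"

end

theory Submission
  imports Defs
begin

text \<open>With \<open>y\<close> the scaled temperature as a function of \<open>\<eta> = x / (2 * a * sqrt t)\<close>, the heat equation becomes
\<open>(L y * y')' = - 2 * \<eta> * L y * y'\<close>, where \<open>L u = 1 + \<delta> * u\<^sup>p\<close>. The same factor \<open>L\<close> appears on both sides because
conductivity and specific heat depend on the temperature in the same way. Hence \<open>L y * y'\<close> is a multiple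
\<open>- A\<close> of \<open>exp (- \<eta>\<^sup>2)\<close>, and in terms of the antiderivative \<open>G\<close> of \<open>L\<close> (the Kirchhoff transform, an increasing
bijection) and of \<open>E \<eta> = \<integral>\<^sub>0\<^sup>\<eta> exp (- r\<^sup>2) dr\<close>, the condition \<open>y = 0\<close> at the front \<open>\<eta> = lam\<close> gives
\<open>G (y \<eta>) = A * (E lam - E \<eta>)\<close>. The Stefan condition fixes \<open>A\<close> as a constant times \<open>lam * exp (lam\<^sup>2)\<close>.
So similarity solutions are explicit up to the single number \<open>lam\<close>: the functions obtained in this
way solve the problem (\<open>stefan_common_temp\<close>), and every similarity solution is one of them
(\<open>similarity_profile_unique\<close>).

The condition at \<open>x = 0\<close> is an equation for \<open>lam\<close>. The Robin condition says \<open>y 0 = 1 - A / \<gamma>\<close> and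
the Dirichlet condition says \<open>y 0 = 1\<close>; both have the form \<open>y 0 + \<epsilon> * A = 1\<close>, with \<open>\<epsilon> = 1 / \<gamma>\<close> and \<open>\<epsilon> = 0\<close>.
The left side is continuous and strictly increasing in \<open>lam\<close>, vanishes at \<open>0\<close> and is unbounded, so there
is exactly one root for each \<open>\<epsilon> \<ge> 0\<close> (\<open>balance_unique_root\<close>), and both problems are uniquely
solvable. The left side is also increasing in \<open>\<epsilon>\<close> and tends to its value at \<open>\<epsilon> = 0\<close>, so the root tends
to the Dirichlet root as \<open>\<gamma> \<rightarrow> \<infinity>\<close> (\<open>front_parameter_tendsto\<close>). Front and temperature depend continuously
on \<open>lam\<close>, which gives the pointwise convergence.\<close>

section \<open>The Kirchhoff transform\<close>

text \<open>The conductivity relative to its reference value, as a function of the scaled temperature \<open>u\<close>.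
The absolute value extends it evenly to negative \<open>u\<close>, which makes the temperature profiles below
smooth on the whole line, so that one-sided derivatives at the two boundaries come for free.\<close>

definition cond_ratio :: "real \<Rightarrow> real \<Rightarrow> real \<Rightarrow> real" where
  "cond_ratio \<delta> p u = 1 + \<delta> * rpow \<bar>u\<bar> p"

text \<open>The odd antiderivative of \<^const>\<open>cond_ratio\<close>. In the new unknown \<open>kirchhoff \<delta> p y\<close> the nonlinear
flux \<open>cond_ratio \<delta> p y * y'\<close> becomes a plain derivative.\<close>

definition kirchhoff :: "real \<Rightarrow> real \<Rightarrow> real \<Rightarrow> real" where
  "kirchhoff \<delta> p u = u + \<delta> / (p + 1) * (u * rpow \<bar>u\<bar> p)"

lemma rpow_nonneg: "0 \<le> rpow u p"
  by (simp add: rpow_def)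

lemma kirchhoff_0 [simp]: "kirchhoff \<delta> p 0 = 0"
  by (simp add: kirchhoff_def)

lemma cond_ratio_ge_1: "0 \<le> \<delta> \<Longrightarrow> 1 \<le> cond_ratio \<delta> p u"
  by (simp add: cond_ratio_def rpow_nonneg)

lemma cond_ratio_pos: "0 \<le> \<delta> \<Longrightarrow> 0 < cond_ratio \<delta> p u"
  using cond_ratio_ge_1[of \<delta> p u] by linarith

lemma kirchhoff_minus: "kirchhoff \<delta> p (- u) = - kirchhoff \<delta> p u"
  by (simp add: kirchhoff_def)

lemma isCont_rpow_abs:
  assumes "0 \<le> p" shows "isCont (\<lambda>u. rpow \<bar>u\<bar> p) x"
proof (cases "p = 0")
  case True
  then show ?thesis by (simp add: rpow_def)
next
  case False
  then have "(\<lambda>u. rpow \<bar>u\<bar> p) = (\<lambda>u. \<bar>u\<bar> powr p)"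
    by (simp add: rpow_def)
  moreover have "continuous_on UNIV (\<lambda>u::real. \<bar>u\<bar> powr p)"
    using assms False by (intro continuous_on_powr') (auto intro!: continuous_intros)
  ultimately show ?thesis
    by (simp add: continuous_on_eq_continuous_at)
qed

text \<open>Away from the origin this is the power rule, transported to negative arguments by oddness.\<close>

lemma kirchhoff_deriv:
  assumes "0 \<le> p"
  shows "(kirchhoff \<delta> p has_real_derivative cond_ratio \<delta> p u) (at u)"
proof -
  have pos: "(kirchhoff \<delta> p has_real_derivative cond_ratio \<delta> p u) (at u)" if "0 < u" for u
  proof -
    have *: "((\<lambda>v. v + \<delta> / (p + 1) * v powr (p + 1)) has_real_derivative
        1 + \<delta> / (p + 1) * ((p + 1) * u powr p)) (at u)"
      using that by (auto intro!: derivative_eq_intros)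
    have "(kirchhoff \<delta> p has_real_derivative 1 + \<delta> / (p + 1) * ((p + 1) * u powr p)) (at u)"
    proof (rule has_field_derivative_transform_within_open[OF *])
      show "v + \<delta> / (p + 1) * v powr (p + 1) = kirchhoff \<delta> p v" if "v \<in> {0<..}" for v
        using that by (simp add: kirchhoff_def rpow_def powr_add mult_ac)
    qed (use that in auto)
    then show ?thesis
      using that assms by (cases "p = 0") (simp_all add: cond_ratio_def rpow_def)
  qed
  consider "0 < u" | "u = 0" | "u < 0" by linarith
  then show ?thesis
  proof cases
    case 1 then show ?thesis by (rule pos)
  next
    case 3
    have "((\<lambda>v. - kirchhoff \<delta> p (- v)) has_real_derivative - (cond_ratio \<delta> p (- u) * - 1)) (at u)"
      using 3 by (intro derivative_intros DERIV_chain2[where f = "kirchhoff \<delta> p"] pos) (auto intro!: derivative_eq_intros)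
    then show ?thesis
      by (simp add: kirchhoff_minus cond_ratio_def add.commute)
  next
    case 2
    \<comment> \<open>At the origin the difference quotient is explicit; for \<open>p = 0\<close> the factor \<open>p + 1\<close> is \<open>1\<close>,
      and for \<open>p > 0\<close> the nonlinear term vanishes in the limit.\<close>
    have "((\<lambda>h. 1 + \<delta> / (p + 1) * rpow \<bar>h\<bar> p) \<longlongrightarrow> 1 + \<delta> / (p + 1) * rpow \<bar>0\<bar> p) (at 0)"
      using isCont_rpow_abs[OF assms, of 0] by (intro tendsto_intros) (simp add: isCont_def)
    moreover have "1 + \<delta> / (p + 1) * rpow \<bar>0\<bar> p = cond_ratio \<delta> p 0"
      by (simp add: cond_ratio_def rpow_def)
    ultimately have "((\<lambda>h. 1 + \<delta> / (p + 1) * rpow \<bar>h\<bar> p) \<longlongrightarrow> cond_ratio \<delta> p 0) (at 0)"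
      by simp
    then have "((\<lambda>h. (kirchhoff \<delta> p (0 + h) - kirchhoff \<delta> p 0) / h) \<longlongrightarrow> cond_ratio \<delta> p 0) (at 0)"
      by (rule Lim_transform_eventually)
        (auto simp: eventually_at_filter kirchhoff_def add_divide_distrib)
    then show ?thesis
      using 2 by (simp add: DERIV_def)
  qed
qed

lemma kirchhoff_isCont: "0 \<le> p \<Longrightarrow> isCont (kirchhoff \<delta> p) u"
  using kirchhoff_deriv DERIV_isCont by blast

lemma kirchhoff_strict_mono:
  assumes "0 \<le> \<delta>" "0 \<le> p"
  shows "strict_mono (kirchhoff \<delta> p)"
proof (rule strict_monoI)
  fix u v :: real assume "u < v"
  then show "kirchhoff \<delta> p u < kirchhoff \<delta> p v"
    using DERIV_pos_imp_increasing[of u v "kirchhoff \<delta> p"] kirchhoff_deriv[OF assms(2)]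
      cond_ratio_pos[OF assms(1)] by blast
qed

lemma kirchhoff_ge:
  assumes "0 \<le> \<delta>" "0 \<le> p" "0 \<le> u"
  shows "u \<le> kirchhoff \<delta> p u"
  using assms by (simp add: kirchhoff_def rpow_nonneg)

text \<open>The transform dominates the identity on the positive half-line, so by oddness it takes every value
\<open>v\<close> between \<open>- \<bar>v\<bar>\<close> and \<open>\<bar>v\<bar>\<close>.\<close>

lemma kirchhoff_surj:
  assumes "0 \<le> \<delta>" "0 \<le> p"
  shows "\<exists>u. kirchhoff \<delta> p u = v"
proof -
  have "\<exists>u\<ge>- \<bar>v\<bar>. u \<le> \<bar>v\<bar> \<and> kirchhoff \<delta> p u = v"
  proof (rule IVT)
    show "v \<le> kirchhoff \<delta> p \<bar>v\<bar>" "kirchhoff \<delta> p (- \<bar>v\<bar>) \<le> v"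
      using kirchhoff_ge[OF assms, of "\<bar>v\<bar>"] by (auto simp: kirchhoff_minus)
  qed (auto simp: kirchhoff_isCont assms)
  then show ?thesis by blast
qed

definition kirchhoff_inv :: "real \<Rightarrow> real \<Rightarrow> real \<Rightarrow> real" where
  "kirchhoff_inv \<delta> p = inv (kirchhoff \<delta> p)"

lemma kirchhoff_kirchhoff_inv:
  assumes "0 \<le> \<delta>" "0 \<le> p"
  shows "kirchhoff \<delta> p (kirchhoff_inv \<delta> p v) = v"
  unfolding kirchhoff_inv_def using kirchhoff_surj[OF assms] by (intro f_inv_into_f) (metis rangeI)

lemma kirchhoff_inv_kirchhoff:
  assumes "0 \<le> \<delta>" "0 \<le> p"
  shows "kirchhoff_inv \<delta> p (kirchhoff \<delta> p u) = u"
  unfolding kirchhoff_inv_def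
  by (intro inv_f_f strict_mono_imp_inj_on[OF kirchhoff_strict_mono] assms)

lemma kirchhoff_inv_eqI:
  "0 \<le> \<delta> \<Longrightarrow> 0 \<le> p \<Longrightarrow> kirchhoff \<delta> p u = v \<Longrightarrow> u = kirchhoff_inv \<delta> p v"
  using kirchhoff_inv_kirchhoff by metis

lemma kirchhoff_inv_isCont:
  assumes "0 \<le> \<delta>" "0 \<le> p"
  shows "isCont (kirchhoff_inv \<delta> p) v"
  using isCont_inverse_function[of 1 "kirchhoff_inv \<delta> p v" "kirchhoff_inv \<delta> p" "kirchhoff \<delta> p"]
  by (simp add: assms kirchhoff_kirchhoff_inv kirchhoff_inv_kirchhoff kirchhoff_isCont)

lemma kirchhoff_inv_deriv:
  assumes "0 \<le> \<delta>" "0 \<le> p"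
  shows "(kirchhoff_inv \<delta> p has_real_derivative 1 / cond_ratio \<delta> p (kirchhoff_inv \<delta> p v)) (at v)"
  using DERIV_inverse_function[where f = "kirchhoff \<delta> p" and g = "kirchhoff_inv \<delta> p" and x = v
      and a = "v - 1" and b = "v + 1", OF kirchhoff_deriv[OF assms(2)]]
    kirchhoff_inv_isCont[OF assms] cond_ratio_pos[OF assms(1)]
  by (simp add: assms kirchhoff_kirchhoff_inv inverse_eq_divide less_imp_neq[symmetric])

lemma kirchhoff_inv_strict_mono:
  assumes "0 \<le> \<delta>" "0 \<le> p"
  shows "strict_mono (kirchhoff_inv \<delta> p)"
  using strict_mono_less[OF kirchhoff_strict_mono[OF assms]] kirchhoff_kirchhoff_inv[OF assms]
  by (metis strict_monoI)

lemma kirchhoff_inv_0: "0 \<le> \<delta> \<Longrightarrow> 0 \<le> p \<Longrightarrow> kirchhoff_inv \<delta> p 0 = 0"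
  using kirchhoff_inv_kirchhoff[of \<delta> p 0] by simp

lemma kirchhoff_inv_nonneg: "0 \<le> \<delta> \<Longrightarrow> 0 \<le> p \<Longrightarrow> 0 \<le> v \<Longrightarrow> 0 \<le> kirchhoff_inv \<delta> p v"
  using strict_mono_less_eq[OF kirchhoff_inv_strict_mono, of \<delta> p 0 v] kirchhoff_inv_0[of \<delta> p] by simp

section \<open>The Gauss integral\<close>

definition gauss_integral :: "real \<Rightarrow> real" where
  "gauss_integral x = (LBINT y=0..x. exp (- y\<^sup>2))"

lemma gauss_integral_0 [simp]: "gauss_integral 0 = 0"
  by (simp add: gauss_integral_def zero_ereal_def)

lemma gauss_integral_deriv: "(gauss_integral has_real_derivative exp (- x\<^sup>2)) (at x)"
proof -
  define b where "b = \<bar>x\<bar> + 1"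
  have "((\<lambda>u. LBINT y=0..u. exp (- y\<^sup>2)) has_vector_derivative exp (- x\<^sup>2)) (at x within {- b..b})"
    unfolding zero_ereal_def
    by (rule interval_integral_FTC2) (auto simp: b_def intro!: continuous_intros)
  moreover have "at x within {- b..b} = at x"
    by (rule at_within_interior) (auto simp: b_def)
  ultimately show ?thesis
    unfolding gauss_integral_def by (simp add: has_real_derivative_iff_has_vector_derivative)
qed

lemma gauss_integral_isCont: "isCont gauss_integral x"
  using gauss_integral_deriv DERIV_isCont by blast

lemma gauss_integral_strict_mono: "strict_mono gauss_integral"
proof (rule strict_monoI)
  fix u v :: real assume "u < v"
  then show "gauss_integral u < gauss_integral v"
    using DERIV_pos_imp_increasing[of u v gauss_integral] gauss_integral_deriv exp_gt_zero by blast
qed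

lemma gauss_integral_pos: "0 < x \<Longrightarrow> 0 < gauss_integral x"
  using strict_monoD[OF gauss_integral_strict_mono, of 0 x] by simp

section \<open>Similarity solutions with a given front parameter\<close>

lemma has_real_derivative_unique_Icc:
  fixes f :: "real \<Rightarrow> real"
  assumes "a < b" "x \<in> {a..b}"
    and "(f has_real_derivative u) (at x within {a..b})"
    and "(f has_real_derivative v) (at x within {a..b})"
  shows "u = v"
  using vector_derivative_unique_within_closed_interval[of a b x f u v] assms
  by (simp add: has_real_derivative_iff_has_vector_derivative cbox_interval)

locale stefan_data =
  fixes \<rho> l k0 c0 T0 Tf \<delta> p a :: real
  assumes rho: "0 < \<rho>" and l: "0 < l" and k0: "0 < k0" and c0: "0 < c0" and Tf: "Tf < T0"
    and delta: "0 \<le> \<delta>" and p: "0 \<le> p"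
    and a_def: "a = sqrt (k0 / (\<rho> * c0))"
begin

lemma a_pos: "0 < a"
  using rho k0 c0 by (simp add: a_def)

lemma diffusivity: "k0 = \<rho> * c0 * a\<^sup>2"
  using rho k0 c0 by (simp add: a_def)

text \<open>The value that the Stefan condition forces on the scaled heat flux \<open>- cond_ratio \<delta> p y * y'\<close> at the
fixed face \<open>\<eta> = 0\<close>: at the front the flux equals \<open>exp (- lam\<^sup>2)\<close> times this number. The factor
\<open>cond_ratio \<delta> p 0\<close> is \<open>1\<close> for \<open>p > 0\<close>, but \<open>1 + \<delta>\<close> for \<open>p = 0\<close>: the Stefan condition is
written with \<open>k0\<close>, which for \<open>p = 0\<close> is not the conductivity at the melting temperature.\<close>

definition front_flux :: "real \<Rightarrow> real" where
  "front_flux lam = 2 * cond_ratio \<delta> p 0 * l / (c0 * (T0 - Tf)) * (lam * exp (lam\<^sup>2))"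

text \<open>The solution of \<open>cond_ratio \<delta> p y * y' = - front_flux lam * exp (- \<eta>\<^sup>2)\<close> with \<open>y = 0\<close> at
\<open>\<eta> = lam\<close>.\<close>

definition profile :: "real \<Rightarrow> real \<Rightarrow> real" where
  "profile lam \<eta> = kirchhoff_inv \<delta> p (front_flux lam * (gauss_integral lam - gauss_integral \<eta>))"

definition temp :: "real \<Rightarrow> real \<Rightarrow> real \<Rightarrow> real" where
  "temp lam x t = (T0 - Tf) * profile lam (x / (2 * a * sqrt t)) + Tf"

definition front :: "real \<Rightarrow> real \<Rightarrow> real" where
  "front lam t = 2 * a * lam * sqrt t"

lemma flux_const_pos: "0 < 2 * cond_ratio \<delta> p 0 * l / (c0 * (T0 - Tf))"
  using l c0 Tf cond_ratio_pos[OF delta] by simp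

lemma front_flux_pos: "0 < lam \<Longrightarrow> 0 < front_flux lam"
  unfolding front_flux_def by (intro mult_pos_pos flux_const_pos) simp_all

lemma thermal_coeff_scaled:
  "0 \<le> y \<Longrightarrow> thermal_coeff \<kappa> T0 Tf \<delta> p ((T0 - Tf) * y + Tf) = \<kappa> * cond_ratio \<delta> p y"
  using Tf by (simp add: thermal_coeff_def cond_ratio_def)

lemma profile_deriv:
  "(profile lam has_real_derivative
     - front_flux lam * exp (- \<eta>\<^sup>2) / cond_ratio \<delta> p (profile lam \<eta>)) (at \<eta>)"
proof -
  have "((\<lambda>\<eta>. front_flux lam * (gauss_integral lam - gauss_integral \<eta>)) has_real_derivative
      - front_flux lam * exp (- \<eta>\<^sup>2)) (at \<eta>)"
    by (auto intro!: derivative_eq_intros gauss_integral_deriv)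
  from DERIV_chain2[OF kirchhoff_inv_deriv[OF delta p] this] show ?thesis
    by (simp add: profile_def[abs_def])
qed

lemma profile_isCont: "isCont (profile lam) \<eta>"
  using profile_deriv DERIV_isCont by blast

lemma profile_front [simp]: "profile lam lam = 0"
  by (simp add: profile_def kirchhoff_inv_0 delta p)

lemma profile_nonneg: "0 < lam \<Longrightarrow> \<eta> \<le> lam \<Longrightarrow> 0 \<le> profile lam \<eta>"
  unfolding profile_def
  using front_flux_pos[of lam] strict_mono_less_eq[OF gauss_integral_strict_mono, of \<eta> lam]
  by (intro kirchhoff_inv_nonneg delta p) simp

lemma temp_x_deriv:
  assumes "0 < t"
  shows "((\<lambda>x. temp lam x t) has_real_derivative
     - ((T0 - Tf) * front_flux lam * exp (- (x / (2 * a * sqrt t))\<^sup>2))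
       / (cond_ratio \<delta> p (profile lam (x / (2 * a * sqrt t))) * (2 * a * sqrt t))) (at x within S)"
proof -
  have "((\<lambda>x. x / (2 * a * sqrt t)) has_real_derivative 1 / (2 * a * sqrt t)) (at x within S)"
    by (rule DERIV_cdivide[OF DERIV_ident])
  from DERIV_chain2[OF profile_deriv this]
  have "((\<lambda>x. profile lam (x / (2 * a * sqrt t))) has_real_derivative
     - front_flux lam * exp (- (x / (2 * a * sqrt t))\<^sup>2)
       / cond_ratio \<delta> p (profile lam (x / (2 * a * sqrt t))) * (1 / (2 * a * sqrt t))) (at x within S)" .
  from DERIV_add[OF DERIV_cmult[OF this, of "T0 - Tf"] DERIV_const[of Tf]]
  show ?thesis
    by (simp add: temp_def[abs_def] mult.assoc)
qed

lemma similarity_variable_deriv: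
  assumes "0 < t"
  shows "((\<lambda>\<tau>. x / (2 * a * sqrt \<tau>)) has_real_derivative - (x / (2 * a * sqrt t)) / (2 * t)) (at t)"
proof -
  have "((\<lambda>\<tau>. x / (2 * a * sqrt \<tau>)) has_real_derivative
      - (x * (2 * a * (inverse (sqrt t) / 2))) / ((2 * a * sqrt t) * (2 * a * sqrt t))) (at t)"
    using assms a_pos by (auto intro!: derivative_eq_intros)
  moreover have "- (x * (2 * a * (inverse (sqrt t) / 2))) / ((2 * a * sqrt t) * (2 * a * sqrt t))
      = - (x / (2 * a * sqrt t)) / (2 * (sqrt t * sqrt t))"
    using assms a_pos by (simp add: field_simps)
  ultimately show ?thesis
    using assms by simp
qed

lemma temp_t_deriv:
  assumes "0 < t"
  shows "((\<lambda>t. temp lam x t) has_real_derivative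
     (T0 - Tf) * (front_flux lam * exp (- (x / (2 * a * sqrt t))\<^sup>2)
       / cond_ratio \<delta> p (profile lam (x / (2 * a * sqrt t)))) * ((x / (2 * a * sqrt t)) / (2 * t))) (at t)"
  using DERIV_add[OF DERIV_cmult[OF DERIV_chain2[OF profile_deriv
        similarity_variable_deriv[OF assms, of x]], of "T0 - Tf"] DERIV_const[of Tf]]
  by (simp add: temp_def[abs_def] mult.assoc)

lemma front_deriv: "0 < t \<Longrightarrow> (front lam has_real_derivative a * lam / sqrt t) (at t)"
  unfolding front_def[abs_def]
  by (auto intro!: derivative_eq_intros simp: field_simps)

lemma similarity_variable_le:
  "0 < t \<Longrightarrow> x \<le> front lam t \<longleftrightarrow> x / (2 * a * sqrt t) \<le> lam"
  using a_pos by (simp add: front_def field_simps)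

text \<open>Conductivity and specific heat are proportional, so for \<open>T = (T0 - Tf) * y + Tf\<close> the heat equation
is linear in the flux \<open>w = cond_ratio \<delta> p y * y'\<close>: it reads \<open>w' = - 2 * \<eta> * w\<close>. For the profile \<open>w\<close> is a
multiple of \<open>exp (- \<eta>\<^sup>2)\<close>.\<close>

lemma heat_equation_temp:
  assumes lam: "0 < lam"
  shows "heat_equation \<rho> (thermal_coeff k0 T0 Tf \<delta> p) (thermal_coeff c0 T0 Tf \<delta> p)
           (temp lam) (front lam)"
  unfolding heat_equation_def
proof (intro allI impI, elim conjE)
  fix t x :: real assume t: "0 < t" and x: "0 < x" "x < front lam t"
  define q where "q = 2 * a * sqrt t"
  have q: "0 < q" using t a_pos by (simp add: q_def)
  have q2: "q\<^sup>2 = 4 * a\<^sup>2 * t" using t by (simp add: q_def power_mult_distrib)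
  let ?L = "\<lambda>\<xi>. cond_ratio \<delta> p (profile lam (\<xi> / q))"
  have L: "0 < ?L \<xi>" for \<xi> by (rule cond_ratio_pos[OF delta])
  have dx: "((\<lambda>z. temp lam z t) has_real_derivative
      - ((T0 - Tf) * front_flux lam * exp (- (\<xi> / q)\<^sup>2)) / (?L \<xi> * q)) (at \<xi>)" for \<xi>
    using temp_x_deriv[OF t] by (simp add: q_def)
  have dt: "((\<lambda>\<tau>. temp lam x \<tau>) has_real_derivative
      (T0 - Tf) * (front_flux lam * exp (- (x / q)\<^sup>2) / ?L x) * ((x / q) / (2 * t))) (at t)"
    using temp_t_deriv[OF t] by (simp add: q_def)
  have coeff: "thermal_coeff \<kappa> T0 Tf \<delta> p (temp lam \<xi> t) = \<kappa> * ?L \<xi>" if "\<xi> \<in> {..< front lam t}" for \<kappa> \<xi>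
    using that profile_nonneg[OF lam] similarity_variable_le[OF t, of \<xi> lam]
    by (simp add: temp_def q_def thermal_coeff_scaled)
  \<comment> \<open>The conductivity cancels in the heat flux, which is a pure Gaussian in the similarity variable.\<close>
  have "((\<lambda>\<xi>. - (k0 * (T0 - Tf) * front_flux lam / q) * exp (- (\<xi> / q)\<^sup>2)) has_real_derivative
      - (k0 * (T0 - Tf) * front_flux lam / q) * (exp (- (x / q)\<^sup>2) * - (2 * (x / q) * (1 / q)))) (at x)"
    using q by (auto intro!: derivative_eq_intros)
  then have dflux: "((\<lambda>\<xi>. thermal_coeff k0 T0 Tf \<delta> p (temp lam \<xi> t) * deriv (\<lambda>z. temp lam z t) \<xi>)
      has_real_derivative
      - (k0 * (T0 - Tf) * front_flux lam / q) * (exp (- (x / q)\<^sup>2) * - (2 * (x / q) * (1 / q)))) (at x)"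
  proof (rule has_field_derivative_transform_within_open[where S = "{..< front lam t}"])
    show "- (k0 * (T0 - Tf) * front_flux lam / q) * exp (- (\<xi> / q)\<^sup>2)
        = thermal_coeff k0 T0 Tf \<delta> p (temp lam \<xi> t) * deriv (\<lambda>z. temp lam z t) \<xi>"
      if "\<xi> \<in> {..< front lam t}" for \<xi>
      using coeff[OF that, of k0] DERIV_imp_deriv[OF dx[of \<xi>]] L[of \<xi>] q by simp
  qed (use x in auto)
  have "\<rho> * thermal_coeff c0 T0 Tf \<delta> p (temp lam x t) * deriv (\<lambda>\<tau>. temp lam x \<tau>) t
      = (T0 - Tf) * front_flux lam * exp (- (x / q)\<^sup>2) * (x / q) * (\<rho> * c0 / (2 * t))"
    using coeff[of x c0] DERIV_imp_deriv[OF dt] L[of x] x by simp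
  also have "\<rho> * c0 / (2 * t) = 2 * k0 / q\<^sup>2"
    unfolding q2 diffusivity using a_pos t by (simp add: field_simps)
  also have "(T0 - Tf) * front_flux lam * exp (- (x / q)\<^sup>2) * (x / q) * (2 * k0 / q\<^sup>2)
      = deriv (\<lambda>\<xi>. thermal_coeff k0 T0 Tf \<delta> p (temp lam \<xi> t) * deriv (\<lambda>z. temp lam z t) \<xi>) x"
    unfolding DERIV_imp_deriv[OF dflux] by (simp add: power2_eq_square)
  finally show "temp lam x field_differentiable at t \<and>
      (\<lambda>\<xi>. temp lam \<xi> t) field_differentiable at x \<and>
      (\<lambda>\<xi>. thermal_coeff k0 T0 Tf \<delta> p (temp lam \<xi> t) * deriv (\<lambda>z. temp lam z t) \<xi>)
        field_differentiable at x \<and>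
      \<rho> * thermal_coeff c0 T0 Tf \<delta> p (temp lam x t) * deriv (temp lam x) t =
      deriv (\<lambda>\<xi>. thermal_coeff k0 T0 Tf \<delta> p (temp lam \<xi> t) * deriv (\<lambda>z. temp lam z t) \<xi>) x"
    using dt dx dflux field_differentiable_def by blast
qed

text \<open>The constant in \<^const>\<open>front_flux\<close> is chosen for this lemma: the factor \<open>exp (lam\<^sup>2)\<close> in it cancels
the Gaussian at the front, and what is left is the speed of the front.\<close>

lemma free_boundary_temp:
  assumes lam: "0 < lam"
  shows "free_boundary_conditions \<rho> l k0 Tf (temp lam) (front lam)"
  unfolding free_boundary_conditions_def
proof (intro conjI allI impI)
  fix t :: real assume t: "0 < t"
  have eta: "front lam t / (2 * a * sqrt t) = lam"
    using a_pos t by (simp add: front_def)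
  show "temp lam (front lam t) t = Tf"
    by (simp add: temp_def eta)
  let ?q = "- ((T0 - Tf) * front_flux lam * exp (- lam\<^sup>2)) / (cond_ratio \<delta> p 0 * (2 * a * sqrt t))"
  have "((\<lambda>x. temp lam x t) has_real_derivative ?q) (at (front lam t) within {0..front lam t})"
    using temp_x_deriv[OF t, of lam "front lam t"] by (simp add: eta)
  moreover have "k0 * ?q = - (\<rho> * l * (a * lam / sqrt t))"
  proof -
    have "(T0 - Tf) * front_flux lam * exp (- lam\<^sup>2) = 2 * cond_ratio \<delta> p 0 * l / c0 * lam"
      using Tf by (simp add: front_flux_def exp_minus)
    then have "k0 * ?q = - (\<rho> * c0 * a\<^sup>2 * (2 * cond_ratio \<delta> p 0 * l / c0 * lam)
        / (cond_ratio \<delta> p 0 * (2 * a * sqrt t)))"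
      unfolding diffusivity by (simp only: times_divide_eq_right mult_minus_right minus_divide_left)
    also have "\<dots> = - (\<rho> * l * (a * lam / sqrt t))"
      using a_pos t c0 cond_ratio_pos[OF delta, of p 0] by (simp add: power2_eq_square)
    finally show ?thesis .
  qed
  ultimately show "\<exists>q v. ((\<lambda>x. temp lam x t) has_real_derivative q) (at (front lam t) within {0..front lam t}) \<and>
      (front lam has_real_derivative v) (at t) \<and> k0 * q = - (\<rho> * l * v)"
    using front_deriv[OF t] by blast
qed (simp add: front_def)

lemma stefan_common_temp:
  assumes lam: "0 < lam"
  shows "stefan_common \<rho> l k0 c0 T0 Tf \<delta> p (temp lam) (front lam)"
  unfolding stefan_common_def
proof (intro conjI heat_equation_temp free_boundary_temp lam)
  have "continuous_on UNIV (profile lam)"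
    by (simp add: profile_isCont continuous_at_imp_continuous_on)
  moreover have "continuous_on {(x, t). 0 < t \<and> 0 \<le> x \<and> x \<le> front lam t}
      (\<lambda>z. fst z / (2 * a * sqrt (snd z)))"
    by (intro continuous_intros) (use a_pos in auto)
  ultimately have "continuous_on {(x, t). 0 < t \<and> 0 \<le> x \<and> x \<le> front lam t}
      (\<lambda>z. profile lam (fst z / (2 * a * sqrt (snd z))))"
    by (rule continuous_on_compose2) simp
  then show "continuous_on {(x, t). 0 < t \<and> 0 \<le> x \<and> x \<le> front lam t} (\<lambda>(x, t). temp lam x t)"
    unfolding temp_def case_prod_unfold by (intro continuous_intros)
qed

lemma similarity_type_temp:
  assumes lam: "0 < lam"
  shows "similarity_type a T0 Tf (temp lam) (front lam)"
  unfolding similarity_type_def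
  using lam profile_nonneg[OF lam]
  by (intro exI[of _ lam] conjI exI[of _ "profile lam"]) (auto simp: temp_def front_def)

lemma dirichlet_temp:
  assumes "0 < lam" "profile lam 0 = 1"
  shows "dirichlet_similarity_solution \<rho> l k0 c0 T0 Tf \<delta> p a (temp lam) (front lam)"
  using assms
  by (simp add: dirichlet_similarity_solution_def stefan_common_temp similarity_type_temp
      dirichlet_condition_def temp_def)

text \<open>The flux at the fixed face is \<^term>\<open>front_flux lam\<close>, so the Robin condition prescribes the surface
value of the profile in terms of \<open>lam\<close> alone.\<close>

lemma robin_temp:
  assumes lam: "0 < lam" and "0 < \<gamma>" and eq: "profile lam 0 = 1 - front_flux lam / \<gamma>"
  shows "robin_similarity_solution \<rho> l k0 c0 T0 Tf \<delta> p a (\<gamma> * k0 / (2 * a)) (temp lam) (front lam)"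
  unfolding robin_similarity_solution_def robin_condition_def
proof (intro conjI stefan_common_temp similarity_type_temp lam allI impI)
  fix t :: real assume t: "0 < t"
  let ?q = "- ((T0 - Tf) * front_flux lam) / (cond_ratio \<delta> p (profile lam 0) * (2 * a * sqrt t))"
  have "((\<lambda>x. temp lam x t) has_real_derivative ?q) (at 0 within {0..front lam t})"
    using temp_x_deriv[OF t, of lam 0] by simp
  moreover have "thermal_coeff k0 T0 Tf \<delta> p (temp lam 0 t) * ?q
      = \<gamma> * k0 / (2 * a) / sqrt t * (temp lam 0 t - T0)"
  proof -
    have "temp lam 0 t - T0 = - ((T0 - Tf) * front_flux lam) / \<gamma>"
      unfolding temp_def using eq by (simp add: right_diff_distrib)
    moreover have "thermal_coeff k0 T0 Tf \<delta> p (temp lam 0 t) = k0 * cond_ratio \<delta> p (profile lam 0)"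
      using profile_nonneg[OF lam, of 0] lam by (simp add: temp_def thermal_coeff_scaled)
    ultimately show ?thesis
      using \<open>0 < \<gamma>\<close> a_pos t cond_ratio_pos[OF delta, of p "profile lam 0"] by simp
  qed
  ultimately show "\<exists>q. ((\<lambda>x. temp lam x t) has_real_derivative q) (at 0 within {0..front lam t}) \<and>
      thermal_coeff k0 T0 Tf \<delta> p (temp lam 0 t) * q = \<gamma> * k0 / (2 * a) / sqrt t * (temp lam 0 t - T0)"
    by blast
qed

section \<open>Every similarity solution has this form\<close>

text \<open>The similarity form makes all times equivalent, so one time slice determines the profile; the
time \<open>t0\<close> with \<open>2 * a * sqrt t0 = 1\<close> is taken, where \<open>x\<close> and the similarity variable coincide. There the
heat equation is the linear equation \<open>W' = - 2 * \<eta> * W\<close> for the flux, hence \<open>W = C * exp (- \<eta>\<^sup>2)\<close>. A second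
integration gives the Kirchhoff transform of \<open>y\<close> on the open interval, and continuity carries it to the closed one.
Only then can the one-sided derivative at the front be computed, and the Stefan condition
identifies the constant \<open>C\<close>.\<close>

lemma similarity_profile_unique:
  assumes common: "stefan_common \<rho> l k0 c0 T0 Tf \<delta> p T s" and lam: "0 < lam"
    and y_nonneg: "\<forall>\<eta>\<in>{0..lam}. 0 \<le> y \<eta>"
    and s: "\<forall>t\<ge>0. s t = 2 * a * lam * sqrt t"
    and T: "\<forall>t>0. \<forall>x\<in>{0..s t}. T x t = (T0 - Tf) * y (x / (2 * a * sqrt t)) + Tf"
  shows "\<forall>\<eta>\<in>{0..lam}. y \<eta> = profile lam \<eta>"
proof -
  \<comment> \<open>At this time the front is at \<open>lam\<close>.\<close>
  define t0 where "t0 = 1 / (4 * a\<^sup>2)"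
  have t0: "0 < t0" using a_pos by (simp add: t0_def)
  have sqrt_t0: "2 * a * sqrt t0 = 1"
    using a_pos by (simp add: t0_def real_sqrt_divide real_sqrt_mult)
  have s_t0: "s t0 = lam"
    using s t0 sqrt_t0 by (metis less_imp_le mult.assoc mult.commute mult_1)
  have D: "0 < T0 - Tf" using Tf by simp
  have T_t0: "T x t0 = (T0 - Tf) * y x + Tf" if "x \<in> {0..lam}" for x
    using T[rule_format, OF t0, of x] that s_t0 sqrt_t0 by simp
  have y_T: "y x = (T x t0 - Tf) / (T0 - Tf)" if "x \<in> {0..lam}" for x
    using T_t0[OF that] D by simp
  have y_deriv_within: "(y has_real_derivative q / (T0 - Tf)) (at x within {0..lam})"
    if "((\<lambda>x. T x t0) has_real_derivative q) (at x within {0..lam})" "x \<in> {0..lam}" for q x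
  proof -
    have "((\<lambda>x. (T x t0 - Tf) / (T0 - Tf)) has_real_derivative (q - 0) / (T0 - Tf)) (at x within {0..lam})"
      by (intro DERIV_cdivide DERIV_diff that DERIV_const)
    from has_field_derivative_transform_within[OF this zero_less_one that(2)] show ?thesis
      using y_T by simp
  qed
  note heat = common[unfolded stefan_common_def heat_equation_def, THEN conjunct2, THEN conjunct1,
      rule_format, OF t0, unfolded s_t0]
  have y_deriv: "(y has_real_derivative deriv y x) (at x)" if "x \<in> {0<..<lam}" for x
  proof -
    have "(\<lambda>x. T x t0) field_differentiable (at x)"
      using heat[of x] that by simp
    then obtain q where "((\<lambda>x. T x t0) has_real_derivative q) (at x)"
      unfolding field_differentiable_def by blast
    then have "(y has_real_derivative q / (T0 - Tf)) (at x within {0..lam})"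
      using that by (intro y_deriv_within[OF has_field_derivative_at_within]) auto
    then have "(y has_real_derivative q / (T0 - Tf)) (at x)"
      using that by (simp add: at_within_Icc_at)
    then show ?thesis
      by (metis DERIV_imp_deriv)
  qed
  have T_deriv: "deriv (\<lambda>z. T z t0) x = (T0 - Tf) * deriv y x" if "x \<in> {0<..<lam}" for x
  proof (rule DERIV_imp_deriv)
    have "((\<lambda>x. (T0 - Tf) * y x + Tf) has_real_derivative (T0 - Tf) * deriv y x + 0) (at x)"
      by (intro DERIV_add DERIV_cmult y_deriv that DERIV_const)
    then show "((\<lambda>z. T z t0) has_real_derivative (T0 - Tf) * deriv y x) (at x)"
      using that T_t0
      by (auto intro: has_field_derivative_transform_within_open[where S = "{0<..<lam}"])
  qed
  define W where "W x = cond_ratio \<delta> p (y x) * deriv y x" for x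
  have flux: "(W has_real_derivative - (2 * \<eta> * W \<eta>)) (at \<eta>)" if \<eta>: "\<eta> \<in> {0<..<lam}" for \<eta>
  proof -
    let ?F = "\<lambda>\<xi>. thermal_coeff k0 T0 Tf \<delta> p (T \<xi> t0) * deriv (\<lambda>z. T z t0) \<xi>"
    have coeff: "thermal_coeff \<kappa> T0 Tf \<delta> p (T \<xi> t0) = \<kappa> * cond_ratio \<delta> p (y \<xi>)"
      if "\<xi> \<in> {0<..<lam}" for \<kappa> \<xi>
      using that y_nonneg T_t0[of \<xi>] by (simp add: thermal_coeff_scaled)
    have "((\<lambda>\<tau>. (T0 - Tf) * y (\<eta> / (2 * a * sqrt \<tau>)) + Tf) has_real_derivative
        (T0 - Tf) * (deriv y \<eta> * (- \<eta> / (2 * t0))) + 0) (at t0)"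
      using similarity_variable_deriv[OF t0, of \<eta>] y_deriv[OF \<eta>] sqrt_t0
      by (intro DERIV_add DERIV_cmult DERIV_const DERIV_chain2[where f = y]) simp_all
    then have "((\<lambda>\<tau>. T \<eta> \<tau>) has_real_derivative
        (T0 - Tf) * (deriv y \<eta> * (- \<eta> / (2 * t0))) + 0) (at t0)"
    proof (rule has_field_derivative_transform_within_open)
      \<comment> \<open>The point stays inside the melted region for all times near \<open>t0\<close>.\<close>
      show "open {\<tau>. 0 < \<tau> \<and> \<eta> < 2 * a * lam * sqrt \<tau>}"
        by (intro open_Collect_conj open_Collect_less continuous_intros)
      show "t0 \<in> {\<tau>. 0 < \<tau> \<and> \<eta> < 2 * a * lam * sqrt \<tau>}"
        using t0 \<eta> s s_t0 by (metis (mono_tags, lifting) greaterThanLessThan_iff less_imp_le mem_Collect_eq)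
      show "(T0 - Tf) * y (\<eta> / (2 * a * sqrt \<tau>)) + Tf = T \<eta> \<tau>"
        if "\<tau> \<in> {\<tau>. 0 < \<tau> \<and> \<eta> < 2 * a * lam * sqrt \<tau>}" for \<tau>
        using that \<eta> s T by simp
    qed
    then have dt: "deriv (\<lambda>\<tau>. T \<eta> \<tau>) t0 = - ((T0 - Tf) * deriv y \<eta> * (2 * a\<^sup>2 * \<eta>))"
      using a_pos by (simp add: DERIV_imp_deriv t0_def)
    have "\<rho> * thermal_coeff c0 T0 Tf \<delta> p (T \<eta> t0) * deriv (\<lambda>\<tau>. T \<eta> \<tau>) t0 = deriv ?F \<eta>"
      and "?F field_differentiable at \<eta>"
      using heat[of \<eta>] \<eta> by simp_all
    then have "(?F has_real_derivative - (k0 * (T0 - Tf) * (2 * \<eta> * W \<eta>))) (at \<eta>)"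
      unfolding dt coeff[OF \<eta>] DERIV_deriv_iff_field_differentiable[symmetric]
      by (simp add: W_def diffusivity mult_ac)
    then have "((\<lambda>\<xi>. k0 * (T0 - Tf) * W \<xi>) has_real_derivative - (k0 * (T0 - Tf) * (2 * \<eta> * W \<eta>))) (at \<eta>)"
      by (rule has_field_derivative_transform_within_open[where S = "{0<..<lam}"])
        (use \<eta> coeff T_deriv in \<open>auto simp: W_def\<close>)
    from DERIV_cdivide[OF this, of "k0 * (T0 - Tf)"] show ?thesis
      using k0 D by simp
  qed
  obtain C where C: "W \<eta> * exp (\<eta>\<^sup>2) = C" if "\<eta> \<in> {0<..<lam}" for \<eta>
  proof -
    have "\<exists>C. \<forall>\<eta>\<in>{0<..<lam}. W \<eta> * exp (\<eta>\<^sup>2) = C"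
    proof (rule has_field_derivative_zero_constant)
      fix \<eta> assume \<eta>: "\<eta> \<in> {0<..<lam}"
      have "((\<lambda>\<eta>. W \<eta> * exp (\<eta>\<^sup>2)) has_real_derivative 0) (at \<eta>)"
        by (auto intro!: derivative_eq_intros flux[OF \<eta>] simp: algebra_simps)
      then show "((\<lambda>\<eta>. W \<eta> * exp (\<eta>\<^sup>2)) has_real_derivative 0) (at \<eta> within {0<..<lam})"
        by (rule has_field_derivative_at_within)
    qed simp
    then show ?thesis using that by blast
  qed
  \<comment> \<open>The first integral is needed at both ends of the interval, where the heat equation is not
    assumed; continuity of the temperature up to the boundary gives it there.\<close>
  have y_cont: "continuous_on {0..lam} y"
  proof -
    have "continuous_on {0..lam} (\<lambda>x. (\<lambda>(x, t). T x t) (x, t0))"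
      using common t0 s_t0 unfolding stefan_common_def
      by (intro continuous_on_compose2[where f = "\<lambda>x. (x, t0)" and g = "\<lambda>(x, t). T x t"])
        (auto intro!: continuous_intros)
    then have "continuous_on {0..lam} (\<lambda>x. (T x t0 - Tf) / (T0 - Tf))"
      using D by (intro continuous_intros) auto
    then show ?thesis
      using continuous_on_cong[of "{0..lam}" "{0..lam}" y] y_T by simp
  qed
  have first_integral: "kirchhoff \<delta> p (y \<eta>) = kirchhoff \<delta> p (y 0) + C * gauss_integral \<eta>"
    if "\<eta> \<in> {0..lam}" for \<eta>
  proof -
    let ?H = "\<lambda>\<eta>. kirchhoff \<delta> p (y \<eta>) - C * gauss_integral \<eta>"
    have "?H \<eta> = ?H 0"
    proof (rule DERIV_isconst2[OF lam])
      show "continuous_on {0..lam} ?H"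
        by (intro continuous_intros continuous_on_compose2[OF _ y_cont, of UNIV "kirchhoff \<delta> p"])
          (auto simp: kirchhoff_isCont[OF p] gauss_integral_isCont continuous_at_imp_continuous_on)
      fix x assume "0 < x" "x < lam"
      then have x: "x \<in> {0<..<lam}" by simp
      have "C * exp (- x\<^sup>2) = W x"
        using C[OF x] by (simp add: exp_minus field_simps)
      moreover have "(?H has_real_derivative W x - C * exp (- x\<^sup>2)) (at x)"
        unfolding W_def
        by (intro DERIV_diff DERIV_cmult gauss_integral_deriv
            DERIV_chain2[OF kirchhoff_deriv[OF p] y_deriv[OF x]])
      ultimately show "(?H has_real_derivative 0) (at x)" by simp
    qed (use that in auto)
    then show ?thesis by simp
  qed
  have flux_within: "cond_ratio \<delta> p (y x) * (q / (T0 - Tf)) = C * exp (- x\<^sup>2)"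
    if "((\<lambda>x. T x t0) has_real_derivative q) (at x within {0..lam})" "x \<in> {0..lam}" for q x
  proof (rule has_real_derivative_unique_Icc[OF lam that(2)])
    show "((\<lambda>x. kirchhoff \<delta> p (y x)) has_real_derivative cond_ratio \<delta> p (y x) * (q / (T0 - Tf)))
        (at x within {0..lam})"
      by (intro DERIV_chain2[OF kirchhoff_deriv[OF p]] y_deriv_within that)
    have "((\<lambda>x. kirchhoff \<delta> p (y 0) + C * gauss_integral x) has_real_derivative 0 + C * exp (- x\<^sup>2))
        (at x within {0..lam})"
      by (intro DERIV_add DERIV_const DERIV_cmult has_field_derivative_at_within[OF gauss_integral_deriv])
    then have "((\<lambda>x. kirchhoff \<delta> p (y x)) has_real_derivative 0 + C * exp (- x\<^sup>2)) (at x within {0..lam})"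
      by (rule has_field_derivative_transform_within[OF _ zero_less_one that(2)])
        (erule first_integral[symmetric])
    then show "((\<lambda>x. kirchhoff \<delta> p (y x)) has_real_derivative C * exp (- x\<^sup>2)) (at x within {0..lam})"
      by simp
  qed
  obtain q v where T_front: "T lam t0 = Tf"
    and q: "((\<lambda>x. T x t0) has_real_derivative q) (at lam within {0..lam})"
    and v: "(s has_real_derivative v) (at t0)" and stefan: "k0 * q = - (\<rho> * l * v)"
    using common[unfolded stefan_common_def free_boundary_conditions_def, THEN conjunct2, THEN conjunct2,
        THEN conjunct2, rule_format, OF t0, unfolded s_t0] by blast
  have y_front: "y lam = 0"
    using y_T[of lam] T_front lam by simp
  have "(s has_real_derivative a * lam / sqrt t0) (at t0)"
    by (rule has_field_derivative_transform_within_open[OF front_deriv[OF t0], of "{0<..}"])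
      (use s t0 in \<open>auto simp: front_def\<close>)
  then have "v = a * lam / sqrt t0"
    using v DERIV_unique by blast
  also have "\<dots> = 2 * a\<^sup>2 * lam * (1 / (2 * a * sqrt t0))"
    using a_pos t0 by (simp add: power2_eq_square)
  finally have "v = 2 * a\<^sup>2 * lam"
    using sqrt_t0 by simp
  then have "\<rho> * a\<^sup>2 * (c0 * q) = \<rho> * a\<^sup>2 * (- (2 * l * lam))"
    using stefan by (simp add: diffusivity mult_ac)
  moreover have "\<rho> * a\<^sup>2 \<noteq> 0"
    using rho a_pos by simp
  ultimately have "c0 * q = - (2 * l * lam)"
    using mult_left_cancel by blast
  then have q_eq: "q = - (2 * l * lam) / c0"
    using c0 by (simp add: field_simps)
  have "C * exp (- lam\<^sup>2) = cond_ratio \<delta> p 0 * (q / (T0 - Tf))"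
    using flux_within[OF q] lam y_front by simp
  then have "C * (exp (- lam\<^sup>2) * exp (lam\<^sup>2)) = cond_ratio \<delta> p 0 * (q / (T0 - Tf)) * exp (lam\<^sup>2)"
    by (metis mult.assoc)
  then have "C = cond_ratio \<delta> p 0 * (q / (T0 - Tf)) * exp (lam\<^sup>2)"
    by (simp add: exp_add[symmetric])
  then have C_eq: "C = - front_flux lam"
    unfolding q_eq front_flux_def by simp
  show ?thesis
  proof
    fix \<eta> assume \<eta>: "\<eta> \<in> {0..lam}"
    have "kirchhoff \<delta> p (y \<eta>) = front_flux lam * (gauss_integral lam - gauss_integral \<eta>)"
      using first_integral[OF \<eta>] first_integral[of lam] lam y_front C_eq by (simp add: algebra_simps)
    then show "y \<eta> = profile lam \<eta>"
      unfolding profile_def by (intro kirchhoff_inv_eqI delta p)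
  qed
qed

text \<open>Agreement with the explicit solution where the values are meaningful: nothing is said about
\<open>T\<close> outside the closed melted region.\<close>

definition has_front_parameter ::
    "real \<Rightarrow> (real \<Rightarrow> real \<Rightarrow> real) \<Rightarrow> (real \<Rightarrow> real) \<Rightarrow> bool" where
  "has_front_parameter lam T s \<longleftrightarrow>
     (\<forall>t\<ge>0. s t = front lam t) \<and> (\<forall>t>0. \<forall>x\<in>{0..s t}. T x t = temp lam x t)"

lemma similarity_solution_has_front_parameter:
  assumes "stefan_common \<rho> l k0 c0 T0 Tf \<delta> p T s" "similarity_type a T0 Tf T s"
  shows "\<exists>lam>0. has_front_parameter lam T s"
proof -
  obtain lam y where lam: "0 < lam" and y: "\<forall>\<eta>\<in>{0..lam}. 0 \<le> y \<eta>"
    and s: "\<forall>t\<ge>0. s t = 2 * a * lam * sqrt t"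
    and T: "\<forall>t>0. \<forall>x\<in>{0..s t}. T x t = (T0 - Tf) * y (x / (2 * a * sqrt t)) + Tf"
    using assms(2) by (auto simp: similarity_type_def)
  have "T x t = temp lam x t" if t: "0 < t" and x: "x \<in> {0..s t}" for t x
  proof -
    have "x / (2 * a * sqrt t) \<in> {0..lam}"
      using x t s similarity_variable_le[OF t, of x lam] a_pos by (simp add: front_def)
    then show ?thesis
      using similarity_profile_unique[OF assms(1) lam y s T] T t x by (simp add: temp_def)
  qed
  then show ?thesis
    using lam s by (auto simp: has_front_parameter_def front_def)
qed

section \<open>The equation for the front parameter\<close>

text \<open>Robin conditions with \<open>\<epsilon> = 1 / \<gamma>\<close> and the Dirichlet condition, as \<open>\<epsilon> = 0\<close>, are the members of one family
of equations \<open>balance \<epsilon> lam = 1\<close> for the front parameter.\<close>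

definition balance :: "real \<Rightarrow> real \<Rightarrow> real" where
  "balance \<epsilon> lam = profile lam 0 + \<epsilon> * front_flux lam"

lemma dirichlet_balance:
  assumes "dirichlet_similarity_solution \<rho> l k0 c0 T0 Tf \<delta> p a T s"
  shows "\<exists>lam>0. has_front_parameter lam T s \<and> balance 0 lam = 1"
proof -
  obtain lam where lam: "0 < lam" and rep: "has_front_parameter lam T s"
    using assms similarity_solution_has_front_parameter
    by (auto simp: dirichlet_similarity_solution_def)
  have "T 0 1 = T0"
    using assms by (simp add: dirichlet_similarity_solution_def dirichlet_condition_def)
  moreover have "T 0 1 = (T0 - Tf) * profile lam 0 + Tf"
    using rep lam a_pos by (simp add: has_front_parameter_def front_def temp_def)
  ultimately have "(T0 - Tf) * profile lam 0 = T0 - Tf"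
    by linarith
  then have "profile lam 0 = 1"
    using Tf by simp
  then show ?thesis
    using lam rep by (auto simp: balance_def)
qed

text \<open>On the melted region at time \<open>1\<close> the solution is explicit, so uniqueness of one-sided derivatives
replaces the derivative in the Robin condition by the explicit flux.\<close>

lemma robin_balance:
  assumes sol: "robin_similarity_solution \<rho> l k0 c0 T0 Tf \<delta> p a (\<gamma> * k0 / (2 * a)) T s"
    and gamma: "0 < \<gamma>"
  shows "\<exists>lam>0. has_front_parameter lam T s \<and> balance (1 / \<gamma>) lam = 1"
proof -
  obtain lam where lam: "0 < lam" and rep: "has_front_parameter lam T s"
    using sol similarity_solution_has_front_parameter
    by (auto simp: robin_similarity_solution_def)
  have front1: "0 < front lam 1"
    using lam a_pos by (simp add: front_def)
  have s1: "s 1 = front lam 1" and T1: "\<And>x. x \<in> {0..front lam 1} \<Longrightarrow> T x 1 = temp lam x 1"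
    using rep by (auto simp: has_front_parameter_def)
  define y0 where "y0 = profile lam 0"
  obtain q where q: "((\<lambda>x. T x 1) has_real_derivative q) (at 0 within {0..front lam 1})"
    and robin: "thermal_coeff k0 T0 Tf \<delta> p (T 0 1) * q = \<gamma> * k0 / (2 * a) * (T 0 1 - T0)"
    using sol[unfolded robin_similarity_solution_def robin_condition_def, THEN conjunct2, THEN conjunct1,
        rule_format, of 1] by (auto simp: s1)
  have "((\<lambda>x. temp lam x 1) has_real_derivative q) (at 0 within {0..front lam 1})"
    using has_field_derivative_transform_within[OF q zero_less_one] T1 front1 by simp
  moreover have "((\<lambda>x. temp lam x 1) has_real_derivative
      - ((T0 - Tf) * front_flux lam) / (cond_ratio \<delta> p y0 * (2 * a))) (at 0 within {0..front lam 1})"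
    using temp_x_deriv[of 1 lam 0] by (simp add: y0_def)
  ultimately have q_eq: "q = - ((T0 - Tf) * front_flux lam) / (cond_ratio \<delta> p y0 * (2 * a))"
    using front1 by (intro has_real_derivative_unique_Icc[where f = "\<lambda>x. temp lam x 1"]) auto
  have T01: "T 0 1 = (T0 - Tf) * y0 + Tf"
    using T1[of 0] front1 by (simp add: temp_def y0_def)
  have "thermal_coeff k0 T0 Tf \<delta> p (T 0 1) * q = - (k0 * (T0 - Tf) / (2 * a)) * front_flux lam"
    using profile_nonneg[OF lam, of 0] lam cond_ratio_pos[OF delta, of p y0]
    unfolding T01 q_eq by (subst thermal_coeff_scaled) (simp_all add: y0_def)
  moreover have "\<gamma> * k0 / (2 * a) * (T 0 1 - T0) = (k0 * (T0 - Tf) / (2 * a)) * (\<gamma> * (y0 - 1))"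
  proof -
    have "T 0 1 - T0 = (T0 - Tf) * (y0 - 1)"
      unfolding T01 by (simp add: algebra_simps)
    then show ?thesis by simp
  qed
  ultimately have "(k0 * (T0 - Tf) / (2 * a)) * (\<gamma> * (y0 - 1)) = (k0 * (T0 - Tf) / (2 * a)) * (- front_flux lam)"
    using robin by simp
  then have "\<gamma> * (y0 - 1) = - front_flux lam"
    using k0 Tf a_pos by (subst (asm) mult_cancel_left) simp
  then have "balance (1 / \<gamma>) lam = 1"
    using gamma by (simp add: balance_def y0_def field_simps)
  then show ?thesis
    using lam rep by auto
qed

lemma front_flux_strict_mono: "0 \<le> u \<Longrightarrow> u < v \<Longrightarrow> front_flux u < front_flux v"
  unfolding front_flux_def
  by (intro mult_strict_left_mono flux_const_pos mult_strict_mono') (auto intro: power_strict_mono)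

lemma front_flux_isCont: "isCont front_flux lam"
  unfolding front_flux_def[abs_def] by (intro continuous_intros)

lemma profile_isCont_front: "isCont (\<lambda>lam. profile lam \<eta>) lam"
  unfolding profile_def
  by (intro isCont_o2[OF _ kirchhoff_inv_isCont[OF delta p]] continuous_intros front_flux_isCont
      gauss_integral_isCont)

lemma balance_isCont: "isCont (balance \<epsilon>) lam"
  unfolding balance_def[abs_def] by (intro continuous_intros profile_isCont_front front_flux_isCont)

lemma balance_strict_mono:
  assumes "0 \<le> \<epsilon>" "0 \<le> u" "u < v"
  shows "balance \<epsilon> u < balance \<epsilon> v"
proof -
  have "front_flux u * gauss_integral u < front_flux v * gauss_integral v"
    using assms front_flux_strict_mono[of u v] strict_monoD[OF gauss_integral_strict_mono, of u v]
      gauss_integral_pos[of u] front_flux_pos[of u]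
    by (intro mult_strict_mono') (cases "u = 0"; simp add: front_flux_def)+
  then have "profile u 0 < profile v 0"
    using strict_monoD[OF kirchhoff_inv_strict_mono[OF delta p]] by (simp add: profile_def)
  moreover have "\<epsilon> * front_flux u \<le> \<epsilon> * front_flux v"
    using assms front_flux_strict_mono[of u v] by (intro mult_left_mono) auto
  ultimately show ?thesis
    by (simp add: balance_def)
qed

lemma balance_0 [simp]: "balance \<epsilon> 0 = 0"
  by (simp add: balance_def front_flux_def)

text \<open>For \<open>lam \<ge> 1\<close> the Kirchhoff transform of the surface value is at least a positive constant times
\<open>lam\<close>, hence unbounded.\<close>

lemma balance_reaches_1:
  assumes "0 \<le> \<epsilon>"
  shows "\<exists>lam>0. 1 \<le> balance \<epsilon> lam"
proof -
  define K where "K = 2 * cond_ratio \<delta> p 0 * l / (c0 * (T0 - Tf))"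
  have K: "0 < K" using flux_const_pos by (simp add: K_def)
  \<comment> \<open>The second entry makes the lower bound \<open>K * lam * gauss_integral 1\<close> reach the transform of \<open>1\<close>.\<close>
  define lam where "lam = max 1 (kirchhoff \<delta> p 1 / (K * gauss_integral 1))"
  have lam: "1 \<le> lam" by (simp add: lam_def)
  have KE: "0 < K * gauss_integral 1"
    using K gauss_integral_pos[of 1] by simp
  have "kirchhoff \<delta> p 1 \<le> (K * gauss_integral 1) * lam"
    using KE pos_divide_le_eq[of "K * gauss_integral 1" "kirchhoff \<delta> p 1" lam]
    by (simp add: lam_def mult.commute)
  also have "\<dots> = K * (lam * 1) * gauss_integral 1" by simp
  also have "\<dots> \<le> K * (lam * exp (lam\<^sup>2)) * gauss_integral lam"
    using lam K gauss_integral_pos[of 1] strict_mono_less_eq[OF gauss_integral_strict_mono, of 1 lam]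
    by (intro mult_mono) auto
  finally have "kirchhoff \<delta> p 1 \<le> front_flux lam * gauss_integral lam"
    by (simp add: front_flux_def K_def)
  then have "kirchhoff_inv \<delta> p (kirchhoff \<delta> p 1) \<le> profile lam 0"
    using strict_mono_less_eq[OF kirchhoff_inv_strict_mono[OF delta p]] by (simp add: profile_def)
  then have "1 \<le> profile lam 0"
    by (simp add: kirchhoff_inv_kirchhoff delta p)
  moreover have "0 \<le> \<epsilon> * front_flux lam"
    using assms front_flux_pos[of lam] lam by simp
  ultimately show ?thesis
    using lam by (intro exI[of _ lam]) (simp add: balance_def)
qed

lemma balance_unique_root:
  assumes eps: "0 \<le> \<epsilon>"
  shows "\<exists>!lam. 0 < lam \<and> balance \<epsilon> lam = 1"
proof -
  obtain u where u: "0 < u" "1 \<le> balance \<epsilon> u"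
    using balance_reaches_1[OF eps] by blast
  have "\<exists>lam\<ge>0. lam \<le> u \<and> balance \<epsilon> lam = 1"
    by (rule IVT) (use u balance_isCont in auto)
  then obtain lam where "0 \<le> lam" "balance \<epsilon> lam = 1" by blast
  moreover from this have "lam \<noteq> 0" by auto
  ultimately show ?thesis
    using balance_strict_mono[OF eps] by (metis less_irrefl linorder_cases order_le_less)
qed

section \<open>Unique solvability and convergence as the heat transfer coefficient grows\<close>

definition front_parameter :: "real \<Rightarrow> real" where
  "front_parameter \<epsilon> = (THE lam. 0 < lam \<and> balance \<epsilon> lam = 1)"

lemma front_parameter:
  assumes "0 \<le> \<epsilon>"
  shows "0 < front_parameter \<epsilon>" "balance \<epsilon> (front_parameter \<epsilon>) = 1"
  using theI'[OF balance_unique_root[OF assms]] by (simp_all add: front_parameter_def)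

lemma front_parameter_unique:
  "0 \<le> \<epsilon> \<Longrightarrow> 0 < lam \<Longrightarrow> balance \<epsilon> lam = 1 \<Longrightarrow> front_parameter \<epsilon> = lam"
  using balance_unique_root[of \<epsilon>] front_parameter[of \<epsilon>] by blast

text \<open>Since \<open>balance\<close> increases with \<open>\<epsilon>\<close>, the Robin fronts never overtake the Dirichlet front. They
also pass every \<open>u\<close> below it: \<open>balance 0 u < 1\<close>, an inequality that survives for small \<open>\<epsilon>\<close>.\<close>

lemma front_parameter_tendsto: "((\<lambda>\<gamma>. front_parameter (1 / \<gamma>)) \<longlongrightarrow> front_parameter 0) at_top"
proof (rule order_tendstoI)
  fix u assume u: "u < front_parameter 0"
  show "\<forall>\<^sub>F \<gamma> in at_top. u < front_parameter (1 / \<gamma>)"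
  proof (cases "u \<le> 0")
    case True
    show ?thesis
      using eventually_gt_at_top[of 0]
    proof eventually_elim
      case (elim \<gamma>)
      then show ?case
        using True front_parameter(1)[of "1 / \<gamma>"] by simp
    qed
  next
    case False
    have "((\<lambda>\<gamma>. 1 / \<gamma>) \<longlongrightarrow> (0::real)) at_top"
      by (intro tendsto_divide_0[OF tendsto_const] filterlim_at_top_imp_at_infinity filterlim_ident)
    then have "((\<lambda>\<gamma>. balance (1 / \<gamma>) u) \<longlongrightarrow> profile u 0 + 0 * front_flux u) at_top"
      unfolding balance_def by (intro tendsto_intros)
    moreover have "profile u 0 + 0 * front_flux u < 1"
      using balance_strict_mono[of 0 u "front_parameter 0"] False u front_parameter(2)[of 0]
      by (simp add: balance_def)
    ultimately have "\<forall>\<^sub>F \<gamma> in at_top. balance (1 / \<gamma>) u < 1"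
      by (rule order_tendstoD)
    then show ?thesis
      using eventually_gt_at_top[of 0]
    proof eventually_elim
      case (elim \<gamma>)
      show ?case
      proof (rule ccontr)
        assume "\<not> u < front_parameter (1 / \<gamma>)"
        then have "balance (1 / \<gamma>) (front_parameter (1 / \<gamma>)) \<le> balance (1 / \<gamma>) u"
          using balance_strict_mono[of "1 / \<gamma>" "front_parameter (1 / \<gamma>)" u] front_parameter(1)[of "1 / \<gamma>"] elim
          by (cases "front_parameter (1 / \<gamma>) = u") auto
        then show False
          using front_parameter(2)[of "1 / \<gamma>"] elim by simp
      qed
    qed
  qed
next
  fix u assume u: "front_parameter 0 < u"
  show "\<forall>\<^sub>F \<gamma> in at_top. front_parameter (1 / \<gamma>) < u"
    using eventually_gt_at_top[of 0]
  proof eventually_elim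
    case (elim \<gamma>)
    have "1 \<le> balance (1 / \<gamma>) (front_parameter 0)"
      using front_parameter[of 0] front_flux_pos[of "front_parameter 0"] elim
      by (simp add: balance_def)
    also have "\<dots> < balance (1 / \<gamma>) u"
      using balance_strict_mono u front_parameter(1)[of 0] elim by simp
    finally have "balance (1 / \<gamma>) (front_parameter (1 / \<gamma>)) < balance (1 / \<gamma>) u"
      using front_parameter(2)[of "1 / \<gamma>"] elim by simp
    then show ?case
      using balance_strict_mono[of "1 / \<gamma>" u "front_parameter (1 / \<gamma>)"] u front_parameter(1)[of 0] elim
      by (cases "front_parameter (1 / \<gamma>)" u rule: linorder_cases) auto
  qed
qed

lemma dirichlet_solution_form:
  assumes "dirichlet_similarity_solution \<rho> l k0 c0 T0 Tf \<delta> p a T s"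
  shows "has_front_parameter (front_parameter 0) T s"
  using dirichlet_balance[OF assms] front_parameter_unique[of 0] by auto

lemma robin_solution_form:
  assumes "robin_similarity_solution \<rho> l k0 c0 T0 Tf \<delta> p a (\<gamma> * k0 / (2 * a)) T s" "0 < \<gamma>"
  shows "has_front_parameter (front_parameter (1 / \<gamma>)) T s"
  using robin_balance[OF assms] front_parameter_unique[of "1 / \<gamma>"] assms(2) by auto

lemma uniquely_solvableI:
  assumes "P (temp lam) (front lam)" and "\<And>T s. P T s \<Longrightarrow> has_front_parameter lam T s"
  shows "uniquely_solvable P"
  unfolding uniquely_solvable_def
proof (intro conjI exI allI impI ballI; (elim conjE)?)
  show "P (temp lam) (front lam)" by fact
next
  fix T s T' s' t assume "P T s" "P T' s'" "(0::real) \<le> t"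
  then show "s t = s' t"
    using assms(2) by (metis has_front_parameter_def)
next
  fix T s T' s' t x assume sol: "P T s" "P T' s'" and t: "(0::real) < t" and x: "x \<in> {0..s t}"
  have "s t = front lam t" "s' t = front lam t"
    using assms(2)[OF sol(1)] assms(2)[OF sol(2)] t by (auto simp: has_front_parameter_def)
  then show "T x t = T' x t"
    using assms(2)[OF sol(1)] assms(2)[OF sol(2)] t x by (simp add: has_front_parameter_def)
qed

lemma dirichlet_uniquely_solvable:
  "uniquely_solvable (dirichlet_similarity_solution \<rho> l k0 c0 T0 Tf \<delta> p a)"
  using front_parameter[of 0]
  by (intro uniquely_solvableI[of _ "front_parameter 0"] dirichlet_temp dirichlet_solution_form)
    (auto simp: balance_def)

lemma robin_uniquely_solvable:
  assumes "0 < \<gamma>"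
  shows "uniquely_solvable (robin_similarity_solution \<rho> l k0 c0 T0 Tf \<delta> p a (\<gamma> * k0 / (2 * a)))"
  using front_parameter[of "1 / \<gamma>"] assms
  by (intro uniquely_solvableI[of _ "front_parameter (1 / \<gamma>)"] robin_temp robin_solution_form)
    (auto simp: balance_def)

text \<open>Front and temperature are continuous functions of the front parameter, so the convergence of the
front parameters is all that is needed. For the temperature at \<open>x\<close> the front has to be past \<open>x\<close>, since
otherwise the value is unconstrained.\<close>

lemma robin_tendsto_dirichlet:
  assumes robin: "\<forall>\<gamma>>0. robin_similarity_solution \<rho> l k0 c0 T0 Tf \<delta> p a (\<gamma> * k0 / (2 * a)) (T\<gamma> \<gamma>) (s\<gamma> \<gamma>)"
    and dirichlet: "dirichlet_similarity_solution \<rho> l k0 c0 T0 Tf \<delta> p a T s"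
    and t: "0 < t"
  shows "((\<lambda>\<gamma>. s\<gamma> \<gamma> t) \<longlongrightarrow> s t) at_top"
    and "0 < x \<Longrightarrow> x < s t \<Longrightarrow> \<forall>\<^sub>F \<gamma> in at_top. x < s\<gamma> \<gamma> t"
    and "0 < x \<Longrightarrow> x < s t \<Longrightarrow> ((\<lambda>\<gamma>. T\<gamma> \<gamma> x t) \<longlongrightarrow> T x t) at_top"
proof -
  let ?lam = "\<lambda>\<gamma>. front_parameter (1 / \<gamma>)"
  note rep = robin_solution_form[OF robin[rule_format], unfolded has_front_parameter_def]
  note rep0 = dirichlet_solution_form[OF dirichlet, unfolded has_front_parameter_def]
  have "((\<lambda>\<gamma>. front (?lam \<gamma>) t) \<longlongrightarrow> front (front_parameter 0) t) at_top"
    unfolding front_def by (intro tendsto_intros front_parameter_tendsto)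
  moreover have "\<forall>\<^sub>F \<gamma> in at_top. front (?lam \<gamma>) t = s\<gamma> \<gamma> t"
    using eventually_gt_at_top[of 0] by eventually_elim (use rep t in auto)
  ultimately show s_lim: "((\<lambda>\<gamma>. s\<gamma> \<gamma> t) \<longlongrightarrow> s t) at_top"
    using rep0 t by (auto elim: Lim_transform_eventually)
  assume x: "0 < x" "x < s t"
  show inside: "\<forall>\<^sub>F \<gamma> in at_top. x < s\<gamma> \<gamma> t"
    using order_tendstoD(1)[OF s_lim x(2)] .
  have "((\<lambda>\<gamma>. profile (?lam \<gamma>) \<eta>) \<longlongrightarrow> profile (front_parameter 0) \<eta>) at_top" for \<eta>
    by (rule isCont_tendsto_compose[OF profile_isCont_front front_parameter_tendsto])
  then have "((\<lambda>\<gamma>. temp (?lam \<gamma>) x t) \<longlongrightarrow> temp (front_parameter 0) x t) at_top"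
    unfolding temp_def by (intro tendsto_intros)
  moreover have "\<forall>\<^sub>F \<gamma> in at_top. temp (?lam \<gamma>) x t = T\<gamma> \<gamma> x t"
    using eventually_gt_at_top[of 0] inside by eventually_elim (use rep t x in auto)
  ultimately show "((\<lambda>\<gamma>. T\<gamma> \<gamma> x t) \<longlongrightarrow> T x t) at_top"
    using rep0 t x by (auto elim: Lim_transform_eventually)
qed

end


theorem theorem4p3:
  fixes \<rho> l k0 c0 T0 Tf \<delta> p a :: real
  assumes "0 < \<rho>" "0 < l" "0 < k0" "0 < c0" "0 < T0" "Tf < T0" "0 \<le> \<delta>" "0 \<le> p"
    and "a = sqrt (k0 / (\<rho> * c0))"
  shows "(\<forall>\<gamma>>0. uniquely_solvable
            (robin_similarity_solution \<rho> l k0 c0 T0 Tf \<delta> p a (\<gamma> * k0 / (2 * a)))) \<and>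
         uniquely_solvable (dirichlet_similarity_solution \<rho> l k0 c0 T0 Tf \<delta> p a) \<and>
         (\<forall>(T\<gamma> :: real \<Rightarrow> real \<Rightarrow> real \<Rightarrow> real) (s\<gamma> :: real \<Rightarrow> real \<Rightarrow> real) T s.
            (\<forall>\<gamma>>0. robin_similarity_solution \<rho> l k0 c0 T0 Tf \<delta> p a (\<gamma> * k0 / (2 * a)) (T\<gamma> \<gamma>) (s\<gamma> \<gamma>)) \<and>
            dirichlet_similarity_solution \<rho> l k0 c0 T0 Tf \<delta> p a T s \<longrightarrow>
              (\<forall>t>0. ((\<lambda>\<gamma>. s\<gamma> \<gamma> t) \<longlongrightarrow> s t) at_top) \<and>
              (\<forall>t>0. \<forall>x. 0 < x \<and> x < s t \<longrightarrow>
                 (\<forall>\<^sub>F \<gamma> in at_top. x < s\<gamma> \<gamma> t) \<and> ((\<lambda>\<gamma>. T\<gamma> \<gamma> x t) \<longlongrightarrow> T x t) at_top))"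
proof -
  interpret stefan_data \<rho> l k0 c0 T0 Tf \<delta> p a
    using assms by unfold_locales
  show ?thesis
    by (intro conjI allI impI; (elim conjE)?)
      (rule robin_uniquely_solvable dirichlet_uniquely_solvable robin_tendsto_dirichlet; assumption)+
qed

end
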